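(* Let $K$ be a martingale kernel on $(0,\infty)$ and, for $x>0$, let $S=(S_k)_{k\in\mathbb{N}_0}$ be under $\mathbb{P}_x$ the positive Markov martingale with transition kernel $K$ started from $S_0=x$. For $x>0$ let $$a(x):=\mathbb{P}_x[S_1<x]=K(x,(0,x)),\qquad b(x):=\mathbb{E}_x\Big[\frac{S_1}{x}\mathbf{1}_{\{S_1<x\}}\Big]=\int_{(0,x)}\frac{y}{x}\,K(x,\mathrm{d}y).$$ Suppose $\inf_{x>0}a(x)>0$. Consider the equation $$M(x)=\int_{[x,\infty)}M(y)\,K(x,\mathrm{d}y),\quad x>0. \qquad(\ast)$$ Then the following are equivalent: (a) $\sup_{x>0}x\,b(x)<\infty$. (b) For all $L>0$ sufficiently large, the call function $M(x)=(x-L)^+$ is a subsolution to $(\ast)$. (c) The default function $M_S$ of $S$ is non-trivial (not identically zero) and satisfies $\|\mathrm{id}-M_S\|_{\sup}<\infty$. Moreover, if one of the conditions (a), (b), (c) is satisfied, $M_S$ is the unique solution to $(\ast)$ among all solutions $M\in\mathcal{I}$ satisfying $\|\mathrm{id}-M\|_{\sup}<\infty$.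
   Context: Martingale kernel: $K:(0,\infty)\times\mathcal{B}_{(0,\infty)}\to[0,\infty)$ is a Markov (probability) kernel on $(0,\infty)$ with $\int_{(0,\infty)}y\,K(x,\mathrm{d}y)=x$ for all $x>0$. For $x>0$, under $\mathbb{P}_x$ (with expectation $\mathbb{E}_x$) the process $S=(S_k)_{k\in\mathbb{N}_0}$ is the time-homogeneous Markov chain with $S_0=x$ and transition kernel $K$; it is a positive martingale, with $\mathbb{P}_x$-a.s. limit $S_\infty$. Default function: $M_S:(0,\infty)\to[0,\infty)$, $M_S(x):=\lim_{n\to\infty}\mathbb{E}_x\big[(S_n-S_\infty)\mathbf{1}_{\{S_n\ge S_{n-1}\ge\dots\ge S_1\ge x\}}\big]$. $\mathcal{I}$ is the set of Borel-measurable $M:(0,\infty)\to[0,\infty)$ with $M(x)\le x$ for all $x>0$. A function $M\in\mathcal{I}$ is a subsolution to $(\ast)$ if $M(x)\le\int_{[x,\infty)}M(y)K(x,\mathrm{d}y)$ for all $x>0$. $\mathrm{id}$ is the identity function on $(0,\infty)$ and $\|\cdot\|_{\sup}$ the supremum norm over $(0,\infty)$. *)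

theory Defs
  imports "HOL-Probability.Probability"
begin

abbreviation pos_borel :: "real measure" where
  "pos_borel \<equiv> restrict_space borel {0<..}"

definition martingale_kernel :: "(real \<Rightarrow> real measure) \<Rightarrow> bool" where
  "martingale_kernel K \<longleftrightarrow>
     K \<in> pos_borel \<rightarrow>\<^sub>M prob_algebra pos_borel \<and>
     (\<forall>x>0. has_bochner_integral (K x) (\<lambda>y. y) x)"

definition past_algebra :: "'w measure \<Rightarrow> (nat \<Rightarrow> 'w \<Rightarrow> real) \<Rightarrow> nat \<Rightarrow> 'w measure" where
  "past_algebra Q S n =
     sigma (space Q) {S k -` A \<inter> space Q | k A. k \<le> n \<and> A \<in> sets pos_borel}"

text \<open>The Markov property is with respect to the natural filtration: almost surely,
  \<open>Q(S\<^sub>n\<^sub>+\<^sub>1 \<in> B | S\<^sub>0, \<dots>, S\<^sub>n) = K(S\<^sub>n, B)\<close>.\<close>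

definition markov_chain :: "(real \<Rightarrow> real measure) \<Rightarrow> real \<Rightarrow> 'w measure \<Rightarrow> (nat \<Rightarrow> 'w \<Rightarrow> real) \<Rightarrow> bool" where
  "markov_chain K x Q S \<longleftrightarrow>
     prob_space Q \<and>
     (\<forall>n. S n \<in> Q \<rightarrow>\<^sub>M pos_borel) \<and>
     (AE \<omega> in Q. S 0 \<omega> = x) \<and>
     (\<forall>n. \<forall>B\<in>sets pos_borel. AE \<omega> in Q.
        real_cond_exp Q (past_algebra Q S n) (\<lambda>\<omega>. indicat_real B (S (Suc n) \<omega>)) \<omega>
          = measure (K (S n \<omega>)) B)"

text \<open>Where the path \<open>S \<omega>\<close> does not converge, the value of \<open>S_lim\<close> is
  irrelevant: for a positive martingale this happens only on a null set.\<close>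

definition S_lim :: "(nat \<Rightarrow> 'w \<Rightarrow> real) \<Rightarrow> 'w \<Rightarrow> real" where
  "S_lim S \<omega> = lim (\<lambda>n. S n \<omega>)"

definition default_function :: "(real \<Rightarrow> 'w measure) \<Rightarrow> (nat \<Rightarrow> 'w \<Rightarrow> real) \<Rightarrow> real \<Rightarrow> real" where
  "default_function P S x =
     lim (\<lambda>n. LINT \<omega>|P x. (S n \<omega> - S_lim S \<omega>) *
       indicat_real {\<omega>. x \<le> S 1 \<omega> \<and> (\<forall>k\<in>{1..<n}. S k \<omega> \<le> S (Suc k) \<omega>)} \<omega>)"

definition down_prob :: "(real \<Rightarrow> real measure) \<Rightarrow> real \<Rightarrow> real" where
  "down_prob K x = measure (K x) {0<..<x}"

definition down_mean :: "(real \<Rightarrow> real measure) \<Rightarrow> real \<Rightarrow> real" where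
  "down_mean K x = (LINT y:{0<..<x}|K x. y / x)"

text \<open>Functions on \<open>(0,\<infinity>)\<close> are total functions on the reals, whose values outside
  \<open>(0,\<infinity>)\<close> are never used.\<close>

definition class_I :: "(real \<Rightarrow> real) set" where
  "class_I = {M \<in> borel_measurable pos_borel. \<forall>x>0. 0 \<le> M x \<and> M x \<le> x}"

definition subsolution :: "(real \<Rightarrow> real measure) \<Rightarrow> (real \<Rightarrow> real) \<Rightarrow> bool" where
  "subsolution K M \<longleftrightarrow> M \<in> class_I \<and> (\<forall>x>0. M x \<le> (LINT y:{x..}|K x. M y))"

definition solution :: "(real \<Rightarrow> real measure) \<Rightarrow> (real \<Rightarrow> real) \<Rightarrow> bool" where
  "solution K M \<longleftrightarrow> M \<in> class_I \<and> (\<forall>x>0. M x = (LINT y:{x..}|K x. M y))"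

definition sup_norm :: "(real \<Rightarrow> real) \<Rightarrow> ereal" where
  "sup_norm f = (SUP x\<in>{0<..}. ereal \<bar>f x\<bar>)"

end

theory Submission imports Defs begin

text \<open>
  Let \<open>T f x = \<integral>\<^bsub>[x,\<infinity>)\<^esub> f(y) K(x, dy)\<close> and \<open>q = 1 - inf a < 1\<close>. By the Markov property
  \<open>E\<^sub>x[f(S\<^sub>n); S\<^sub>n \<ge> \<dots> \<ge> S\<^sub>0] = T\<^sup>n f(x)\<close>. In particular the event of \<open>n\<close> consecutive upward steps has
  probability at most \<open>q\<^sup>n\<close>, so the \<open>S\<^sub>\<infinity>\<close>-term of the default function vanishes in the limit and
  \<open>M\<^sub>S = lim T\<^sup>n id\<close>, a decreasing limit that dominates every subsolution and is itself a solution.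

  Since \<open>T id(x) = x - x b(x)\<close>, the call with strike \<open>L\<close> is a subsolution iff \<open>x b(x) \<le> L a(x)\<close> for
  \<open>x \<ge> L\<close>, which gives (a) to (b). A call below \<open>M\<^sub>S\<close> gives (b) to (c), and
  \<open>M\<^sub>S = T M\<^sub>S \<le> T id\<close> gives (c) to (a). Finally \<open>T\<close> contracts bounded functions by the factor \<open>q\<close>,
  so two solutions at bounded distance coincide.
\<close>

subsection \<open>The upward transition operator of a martingale kernel\<close>

text \<open>This is the \<open>T\<close> of the overview. Values in \<open>ennreal\<close> let
  iterates and their infima be formed directly; real integrals are recovered later for functions
  between 0 and the identity.\<close>

definition up_op :: "(real \<Rightarrow> real measure) \<Rightarrow> (real \<Rightarrow> ennreal) \<Rightarrow> real \<Rightarrow> ennreal" where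
  "up_op K f x = (\<integral>\<^sup>+y\<in>{x..}. f y \<partial>K x)"

lemma borel_measurable_id_pos_borel [measurable]: "(\<lambda>y. y) \<in> borel_measurable pos_borel"
  by (rule measurable_restrict_space1) simp

context
  fixes K :: "real \<Rightarrow> real measure"
  assumes K: "martingale_kernel K"
begin

section \<open>The kernel as a family of probability measures on (0,\<infinity>) with mean
  \<open>x\<close>\<close>

lemma kernel_subprob [measurable]: "K \<in> pos_borel \<rightarrow>\<^sub>M subprob_algebra pos_borel"
  using K unfolding martingale_kernel_def by (blast intro: measurable_prob_algebraD)

lemma
  assumes "x > 0"
  shows prob_space_kernel: "prob_space (K x)"
    and sets_martingale_kernel: "sets (K x) = sets pos_borel"
    and space_kernel: "space (K x) = {0<..}"
proof -
  have "K x \<in> space (prob_algebra pos_borel)"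
    using K assms unfolding martingale_kernel_def
    by (auto intro: measurable_space simp: space_restrict_space)
  then show "prob_space (K x)" and *: "sets (K x) = sets pos_borel"
    by (auto simp: space_prob_algebra)
  show "space (K x) = {0<..}"
    using sets_eq_imp_space_eq[OF *] by (simp add: space_restrict_space)
qed

lemma borel_measurable_kernel:
  "x > 0 \<Longrightarrow> f \<in> borel_measurable pos_borel \<Longrightarrow> f \<in> borel_measurable (K x)"
  using sets_martingale_kernel by (simp cong: measurable_cong_sets)

lemma atLeast_sets_kernel: "x > 0 \<Longrightarrow> {x..} \<in> sets (K x)"
  using sets_martingale_kernel[of x] by (auto simp: sets_restrict_space_iff)

lemma greaterThanLessThan_sets_kernel: "x > 0 \<Longrightarrow> {0<..<x} \<in> sets (K x)"
  using sets_martingale_kernel[of x] by (auto simp: sets_restrict_space_iff)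

lemma integrable_kernel_id: "x > 0 \<Longrightarrow> integrable (K x) (\<lambda>y. y)"
  and integral_kernel_id: "x > 0 \<Longrightarrow> (LINT y|K x. y) = x"
  using K unfolding martingale_kernel_def by (auto simp: has_bochner_integral_iff)

lemma nn_integral_kernel_id:
  assumes "x > 0"
  shows "(\<integral>\<^sup>+y. ennreal y \<partial>K x) = ennreal x"
  using assms by (subst nn_integral_eq_integral[OF integrable_kernel_id])
    (auto simp: integral_kernel_id space_kernel)

section \<open>Measurability, monotonicity and iterates of the upward operator\<close>

lemma up_op_measurable [measurable]:
  assumes [measurable]: "f \<in> borel_measurable pos_borel"
  shows "up_op K f \<in> borel_measurable pos_borel"
proof -
  \<comment> \<open>The domain \<open>{x..}\<close> moves with \<open>x\<close>, so its indicator is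
    read as that of the closed half plane \<open>fst p \<le> snd p\<close>; this gives the joint
    measurability needed to integrate against a kernel.\<close>
  have "{p \<in> space (pos_borel \<Otimes>\<^sub>M pos_borel). fst p \<le> snd p} \<in> sets (pos_borel \<Otimes>\<^sub>M pos_borel)"
    by measurable
  moreover have "(\<lambda>(x, y). f y * indicator {p \<in> space (pos_borel \<Otimes>\<^sub>M pos_borel). fst p \<le> snd p} (x, y))
      \<in> borel_measurable (pos_borel \<Otimes>\<^sub>M pos_borel)"
    by measurable
  ultimately have "(\<lambda>(x, y). f y * indicator {x..} y) \<in> borel_measurable (pos_borel \<Otimes>\<^sub>M pos_borel)"
    by (subst measurable_cong[where g="\<lambda>(x, y). f y * indicator {p \<in> space (pos_borel \<Otimes>\<^sub>M pos_borel). fst p \<le> snd p} (x, y)"])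
       (auto simp: indicator_def)
  then show ?thesis
    unfolding up_op_def[abs_def]
    by (rule nn_integral_measurable_subprob_algebra2) (rule kernel_subprob)
qed

lemma up_op_pow_measurable [measurable]:
  "f \<in> borel_measurable pos_borel \<Longrightarrow> (up_op K ^^ n) f \<in> borel_measurable pos_borel"
  by (induction n) (auto intro: up_op_measurable)

lemma up_op_mono:
  assumes "\<And>y. y > 0 \<Longrightarrow> f y \<le> g y" "x > 0"
  shows "up_op K f x \<le> up_op K g x"
  unfolding up_op_def using assms
  by (intro nn_integral_mono) (auto simp: space_kernel intro!: mult_right_mono)

lemma up_op_pow_mono:
  assumes "\<And>y. y > 0 \<Longrightarrow> f y \<le> g y" "x > 0"
  shows "(up_op K ^^ n) f x \<le> (up_op K ^^ n) g x"
  using assms(2) by (induction n arbitrary: x) (auto intro: assms up_op_mono)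

text \<open>Within the space \<open>{0<..}\<close> the half-line \<open>{x..}\<close> is the
  complement of \<open>{0<..<x}\<close>.\<close>

lemma up_op_const:
  assumes "x > 0"
  shows "up_op K (\<lambda>_. c) x = c * ennreal (1 - down_prob K x)"
proof -
  interpret prob_space "K x" by (rule prob_space_kernel[OF assms])
  have "prob {x..} = prob (space (K x) - {0<..<x})"
    using assms by (intro arg_cong[where f=prob]) (auto simp: space_kernel)
  also have "\<dots> = 1 - down_prob K x"
    unfolding down_prob_def using assms greaterThanLessThan_sets_kernel by (intro prob_compl) auto
  finally show ?thesis
    unfolding up_op_def using assms
    by (subst nn_integral_cmult_indicator) (auto simp: atLeast_sets_kernel emeasure_eq_measure)
qed

text \<open>Each application to a constant costs a factor of at most \<open>q\<close>. With
  \<open>c = 1\<close> this will bound the probability of \<open>n\<close> consecutive upward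
  steps.\<close>

lemma up_op_pow_const_le:
  assumes q: "\<And>x. x > 0 \<Longrightarrow> 1 - down_prob K x \<le> q" "0 \<le> q" and "x > 0"
  shows "(up_op K ^^ n) (\<lambda>_. c) x \<le> c * ennreal (q ^ n)"
  using \<open>x > 0\<close>
proof (induction n arbitrary: x)
  case (Suc n)
  have "(up_op K ^^ Suc n) (\<lambda>_. c) x \<le> up_op K (\<lambda>_. c * ennreal (q ^ n)) x"
    using Suc by (auto intro: up_op_mono)
  also have "\<dots> \<le> c * ennreal (q ^ n) * ennreal q"
    using Suc.prems q by (auto simp: up_op_const intro!: mult_left_mono ennreal_leI)
  also have "\<dots> = c * ennreal (q ^ Suc n)"
    using q by (simp add: ennreal_mult mult_ac)
  finally show ?case .
qed simp

text \<open>Dropping the restriction to \<open>{x..}\<close> can only raise the integral, and the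
  full integral is the martingale mean \<open>x\<close>.\<close>

lemma up_op_id_le: "x > 0 \<Longrightarrow> up_op K ennreal x \<le> ennreal x"
  unfolding up_op_def
  by (subst (2) nn_integral_kernel_id[symmetric]) (auto intro!: nn_integral_mono simp: indicator_def)

lemma up_op_pow_id_Suc_le: "x > 0 \<Longrightarrow> (up_op K ^^ Suc n) ennreal x \<le> (up_op K ^^ n) ennreal x"
  unfolding funpow_Suc_right comp_def by (rule up_op_pow_mono) (auto intro: up_op_id_le)

text \<open>Monotone convergence for a decreasing sequence whose first term has finite integral
  \<open>T id x \<le> x\<close>; shifting the index then leaves the infimum unchanged. So the limit
  of the iterates is a fixed point of \<open>T\<close>.\<close>

lemma up_op_INF_pow_id:
  assumes "x > 0"
  shows "up_op K (\<lambda>y. INF n. (up_op K ^^ n) ennreal y) x = (INF n. (up_op K ^^ n) ennreal x)"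
proof -
  let ?f = "\<lambda>n y. (up_op K ^^ n) ennreal y * indicator {x..} y"
  have "up_op K (\<lambda>y. INF n. (up_op K ^^ n) ennreal y) x = (\<integral>\<^sup>+y. (INF n. ?f n y) \<partial>K x)"
    unfolding up_op_def by (intro nn_integral_cong) (auto simp: indicator_def)
  also have "\<dots> = (INF n. \<integral>\<^sup>+y. ?f n y \<partial>K x)"
  proof (rule nn_integral_monotone_convergence_INF_AE[where i=0])
    show "AE y in K x. ?f (Suc n) y \<le> ?f n y" for n
      using up_op_pow_id_Suc_le[of _ n] assms
      by (intro AE_I2) (auto simp: space_kernel intro!: mult_right_mono)
    show "?f n \<in> borel_measurable (K x)" for n
      using assms atLeast_sets_kernel
      by (intro borel_measurable_times borel_measurable_indicator borel_measurable_kernel up_op_pow_measurable)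
         (auto)
    show "integral\<^sup>N (K x) (?f 0) < \<infinity>"
      using up_op_id_le[OF assms] by (auto simp: up_op_def intro: le_less_trans)
  qed
  also have "\<dots> = (INF n. (up_op K ^^ Suc n) ennreal x)"
    by (simp add: up_op_def)
  also have "\<dots> = (INF n. (up_op K ^^ n) ennreal x)"
  proof (intro antisym INF_greatest)
    show "(INF n. (up_op K ^^ Suc n) ennreal x) \<le> (up_op K ^^ n) ennreal x" for n
      using up_op_pow_id_Suc_le[OF assms, of n] by (intro INF_lower2[of n]) auto
    show "(INF n. (up_op K ^^ n) ennreal x) \<le> (up_op K ^^ Suc n) ennreal x" for n
      by (rule INF_lower) simp
  qed
  finally show ?thesis .
qed

section \<open>Solutions and subsolutions in terms of the upward operator\<close>

lemma
  assumes M: "M \<in> class_I" and x: "x > 0"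
  shows set_integrable_class_I: "set_integrable (K x) {x..} M"
    and set_integral_class_I: "ennreal (LINT y:{x..}|K x. M y) = up_op K (\<lambda>y. ennreal (M y)) x"
proof -
  have M': "\<And>y. y > 0 \<Longrightarrow> 0 \<le> M y \<and> M y \<le> y" "M \<in> borel_measurable pos_borel"
    using M by (auto simp: class_I_def)
  \<comment> \<open>Members of \<open>class_I\<close> lie between 0 and the identity, which is
    integrable under the martingale kernel.\<close>
  have "integrable (K x) M"
    using M' x by (intro Bochner_Integration.integrable_bound[OF integrable_kernel_id] borel_measurable_kernel AE_I2)
      (auto simp: space_kernel)
  then show *: "set_integrable (K x) {x..} M"
    unfolding set_integrable_def using x by (intro integrable_mult_indicator atLeast_sets_kernel)
  show "ennreal (LINT y:{x..}|K x. M y) = up_op K (\<lambda>y. ennreal (M y)) x"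
    unfolding set_lebesgue_integral_def up_op_def
    using M' x by (subst nn_integral_eq_integral[OF *[unfolded set_integrable_def], symmetric])
      (auto intro!: AE_I2 nn_integral_cong simp: space_kernel indicator_def)
qed

text \<open>Comparing through \<open>ennreal\<close> is faithful because the integral on the right
  is nonnegative.\<close>

lemma subsolution_iff_up_op:
  "subsolution K M \<longleftrightarrow> M \<in> class_I \<and> (\<forall>x>0. ennreal (M x) \<le> up_op K (\<lambda>y. ennreal (M y)) x)"
proof -
  have "ennreal (M x) \<le> up_op K (\<lambda>y. ennreal (M y)) x \<longleftrightarrow> M x \<le> (LINT y:{x..}|K x. M y)"
    if "M \<in> class_I" "x > 0" for x
  proof -
    have "0 \<le> (LINT y:{x..}|K x. M y)"
      unfolding set_lebesgue_integral_def using that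
      by (intro Bochner_Integration.integral_nonneg_AE AE_I2) (auto simp: space_kernel class_I_def)
    then show ?thesis using that by (simp add: set_integral_class_I[symmetric])
  qed
  then show ?thesis by (auto simp: subsolution_def)
qed

lemma solution_iff_up_op:
  "solution K M \<longleftrightarrow> M \<in> class_I \<and> (\<forall>x>0. ennreal (M x) = up_op K (\<lambda>y. ennreal (M y)) x)"
proof -
  have "ennreal (M x) = up_op K (\<lambda>y. ennreal (M y)) x \<longleftrightarrow> M x = (LINT y:{x..}|K x. M y)"
    if "M \<in> class_I" "x > 0" for x
  proof -
    have "0 \<le> (LINT y:{x..}|K x. M y)"
      unfolding set_lebesgue_integral_def using that
      by (intro Bochner_Integration.integral_nonneg_AE AE_I2) (auto simp: space_kernel class_I_def)
    moreover have "0 \<le> M x" using that by (auto simp: class_I_def)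
    ultimately show ?thesis using that by (simp add: set_integral_class_I[symmetric])
  qed
  then show ?thesis by (auto simp: solution_def)
qed

lemma subsolution_le_up_op_pow:
  assumes "subsolution K M" "x > 0"
  shows "ennreal (M x) \<le> (up_op K ^^ n) (\<lambda>y. ennreal (M y)) x"
  using assms(2)
proof (induction n arbitrary: x)
  case (Suc n)
  have "ennreal (M x) \<le> up_op K (\<lambda>y. ennreal (M y)) x"
    using assms Suc.prems by (simp add: subsolution_iff_up_op)
  also have "\<dots> \<le> up_op K ((up_op K ^^ n) (\<lambda>y. ennreal (M y))) x"
    using Suc by (intro up_op_mono) auto
  finally show ?case by simp
qed simp

section \<open>Action of the upward operator on the identity and on call functions\<close>

lemma down_mean_eq:
  assumes "x > 0"
  shows "x * down_mean K x = (LINT y:{0<..<x}|K x. y)"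
  using assms unfolding down_mean_def set_lebesgue_integral_def by simp

lemma set_integrable_kernel_id:
  "x > 0 \<Longrightarrow> A \<in> sets (K x) \<Longrightarrow> set_integrable (K x) A (\<lambda>y. y)"
  unfolding set_integrable_def by (intro integrable_mult_indicator integrable_kernel_id)

text \<open>Split the martingale mean \<open>x\<close> at the point \<open>x\<close>.\<close>

lemma set_integral_atLeast_id:
  assumes "x > 0"
  shows "(LINT y:{x..}|K x. y) = x - x * down_mean K x"
proof -
  have "(LINT y:{0<..<x} \<union> {x..}|K x. y) = (LINT y:{0<..<x}|K x. y) + (LINT y:{x..}|K x. y)"
    using assms by (intro set_integral_Un set_integrable_kernel_id atLeast_sets_kernel greaterThanLessThan_sets_kernel) auto
  moreover have "(LINT y:{0<..<x} \<union> {x..}|K x. y) = (LINT y|K x. y)"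
    unfolding set_lebesgue_integral_def using assms
    by (intro Bochner_Integration.integral_cong) (auto simp: space_kernel indicator_def)
  ultimately show ?thesis using assms by (simp add: integral_kernel_id down_mean_eq)
qed

lemma measure_atLeast_kernel:
  assumes "x > 0"
  shows "measure (K x) {x..} = 1 - down_prob K x"
proof -
  interpret prob_space "K x" by (rule prob_space_kernel[OF assms])
  show ?thesis using up_op_const[OF assms, of 1] assms atLeast_sets_kernel[OF assms]
    by (simp add: up_op_def emeasure_eq_measure down_prob_def)
qed

lemma call_in_class_I: "L > 0 \<Longrightarrow> (\<lambda>x. max (x - L) 0) \<in> class_I"
  by (auto simp: class_I_def)

text \<open>For \<open>x \<ge> L\<close> the positive part is inactive on \<open>{x..}\<close>, so
  the integral is \<open>T id x\<close> minus \<open>L\<close> times the mass of the half-line, that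
  is \<open>x - x b(x) - L (1 - a(x))\<close>.\<close>

lemma set_integral_call:
  assumes "L > 0" "L \<le> x"
  shows "(LINT y:{x..}|K x. max (y - L) 0) = x - L + (L * down_prob K x - x * down_mean K x)"
proof -
  have x: "x > 0" using assms by simp
  interpret prob_space "K x" by (rule prob_space_kernel[OF x])
  have "(LINT y:{x..}|K x. max (y - L) 0) = (LINT y:{x..}|K x. y - L)"
    unfolding set_lebesgue_integral_def using assms
    by (intro Bochner_Integration.integral_cong) (auto simp: indicator_def)
  also have "\<dots> = (LINT y:{x..}|K x. y) - (LINT y:{x..}|K x. L)"
    using x atLeast_sets_kernel[OF x]
    by (intro set_integral_diff set_integrable_kernel_id) (auto simp: set_integrable_def less_top[symmetric])
  also have "(LINT y:{x..}|K x. L) = L * measure (K x) {x..}"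
    using atLeast_sets_kernel[OF x] by (simp add: set_lebesgue_integral_def)
  finally show ?thesis
    using x by (simp add: set_integral_atLeast_id measure_atLeast_kernel algebra_simps)
qed

text \<open>Above the strike, \<open>x - L\<close> cancels from both sides; below it the left side
  is 0 and the inequality is automatic.\<close>

lemma subsolution_call_iff:
  assumes "L > 0"
  shows "subsolution K (\<lambda>x. max (x - L) 0) \<longleftrightarrow> (\<forall>x\<ge>L. x * down_mean K x \<le> L * down_prob K x)"
proof -
  have "max (x - L) 0 \<le> (LINT y:{x..}|K x. max (y - L) 0) \<longleftrightarrow>
      (L \<le> x \<longrightarrow> x * down_mean K x \<le> L * down_prob K x)" if x: "x > 0" for x
  proof (cases "L \<le> x")
    case True
    then show ?thesis using set_integral_call[OF assms True] by simp
  next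
    case False
    have "0 \<le> (LINT y:{x..}|K x. max (y - L) 0)"
      unfolding set_lebesgue_integral_def by (intro Bochner_Integration.integral_nonneg_AE AE_I2) auto
    with False show ?thesis by (simp add: max_def)
  qed
  then show ?thesis
    using call_in_class_I[OF assms] assms unfolding subsolution_def
    by (metis less_le_trans)
qed

end

subsection \<open>Upward paths of the Markov chain\<close>

context
  fixes K :: "real \<Rightarrow> real measure" and Q :: "'w measure" and S :: "nat \<Rightarrow> 'w \<Rightarrow> real" and x :: real
  assumes K: "martingale_kernel K" and chain: "markov_chain K x Q S" and x: "x > 0"
begin

interpretation prob_space Q
  using chain by (simp add: markov_chain_def)

section \<open>The natural filtration and the Markov property\<close>

lemma chain_measurable [measurable]: "S n \<in> Q \<rightarrow>\<^sub>M pos_borel"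
  using chain by (simp add: markov_chain_def)

lemma chain_pos: "\<omega> \<in> space Q \<Longrightarrow> S n \<omega> > 0"
  using measurable_space[OF chain_measurable] by (simp add: space_restrict_space)

lemma space_past_algebra: "space (past_algebra Q S n) = space Q"
  unfolding past_algebra_def by (rule space_measure_of) auto

lemma sets_past_algebra:
  "sets (past_algebra Q S n) =
     sigma_sets (space Q) {S k -` A \<inter> space Q | k A. k \<le> n \<and> A \<in> sets pos_borel}"
  unfolding past_algebra_def by (rule sets_measure_of) auto

lemma subalgebra_past_algebra: "subalgebra Q (past_algebra Q S n)"
  unfolding subalgebra_def space_past_algebra sets_past_algebra
  by (auto intro!: sets.sigma_sets_subset measurable_sets[OF chain_measurable])

lemma chain_past_measurable: "k \<le> n \<Longrightarrow> S k \<in> past_algebra Q S n \<rightarrow>\<^sub>M pos_borel"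
proof (rule measurableI)
  show "S k -` A \<inter> space (past_algebra Q S n) \<in> sets (past_algebra Q S n)"
    if "k \<le> n" "A \<in> sets pos_borel" for A
    unfolding space_past_algebra sets_past_algebra using that by blast
qed (use measurable_space[OF chain_measurable] space_past_algebra in auto)

lemma past_algebra_sets_mono: "C \<in> sets (past_algebra Q S n) \<Longrightarrow> C \<in> sets Q"
  using subalgebra_past_algebra[of n] by (auto simp: subalgebra_def)

lemma kernel_chain_measurable [measurable]: "(\<lambda>\<omega>. K (S n \<omega>)) \<in> Q \<rightarrow>\<^sub>M subprob_algebra pos_borel"
  using measurable_compose[OF chain_measurable kernel_subprob[OF K]] .

text \<open>The almost sure Markov property in integrated form: the conditional expectation has the
  same integral over a past event \<open>C\<close> as the indicator of
  \<open>S (Suc n) \<in> B\<close>.\<close>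

lemma emeasure_past_chain_Suc:
  assumes C: "C \<in> sets (past_algebra Q S n)" and B: "B \<in> sets pos_borel"
  shows "emeasure Q (C \<inter> S (Suc n) -` B) = (\<integral>\<^sup>+\<omega>\<in>C. emeasure (K (S n \<omega>)) B \<partial>Q)"
proof -
  interpret F: finite_measure_subalgebra Q "past_algebra Q S n"
    by unfold_locales (rule subalgebra_past_algebra)
  note [measurable] = B past_algebra_sets_mono[OF C]
  have K_meas [measurable]: "(\<lambda>\<omega>. measure (K (S n \<omega>)) B) \<in> borel_measurable Q"
    by (rule measurable_compose[OF kernel_chain_measurable measurable_measure_subprob_algebra[OF B]])
  have K_prob: "prob_space (K (S n \<omega>))" if "\<omega> \<in> space Q" for \<omega>
    using chain_pos[OF that] by (rule prob_space_kernel[OF K])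
  have set_eq: "C \<inter> S (Suc n) -` B = C \<inter> (S (Suc n) -` B \<inter> space Q)"
    using sets.sets_into_space[OF past_algebra_sets_mono[OF C]] by auto
  have "integrable Q (indicat_real (S (Suc n) -` B \<inter> space Q))"
    by (simp add: less_top[symmetric])
  then have int: "integrable Q (\<lambda>\<omega>. indicat_real B (S (Suc n) \<omega>))"
    by (rule Bochner_Integration.integrable_cong[THEN iffD1, rotated -1]) (auto simp: indicator_def)
  have "measure Q (C \<inter> S (Suc n) -` B) = (LINT \<omega>:C|Q. indicat_real B (S (Suc n) \<omega>))"
  proof -
    have "(LINT \<omega>:C|Q. indicat_real B (S (Suc n) \<omega>)) = (LINT \<omega>|Q. indicator (C \<inter> (S (Suc n) -` B \<inter> space Q)) \<omega>)"
      unfolding set_lebesgue_integral_def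
      by (intro Bochner_Integration.integral_cong) (auto simp: indicator_def)
    also have "\<dots> = measure Q (C \<inter> S (Suc n) -` B)"
      unfolding set_eq by simp
    finally show ?thesis by simp
  qed
  also have "\<dots> = (LINT \<omega>:C|Q. real_cond_exp Q (past_algebra Q S n) (\<lambda>\<omega>. indicat_real B (S (Suc n) \<omega>)) \<omega>)"
    by (rule F.real_cond_exp_intA[OF int C])
  also have "\<dots> = (LINT \<omega>:C|Q. measure (K (S n \<omega>)) B)"
    unfolding set_lebesgue_integral_def
  proof (rule integral_cong_AE)
    have "AE \<omega> in Q. real_cond_exp Q (past_algebra Q S n) (\<lambda>\<omega>. indicat_real B (S (Suc n) \<omega>)) \<omega>
        = measure (K (S n \<omega>)) B"
      using chain B by (simp add: markov_chain_def)
    then show "AE \<omega> in Q. indicat_real C \<omega> *\<^sub>R real_cond_exp Q (past_algebra Q S n) (\<lambda>\<omega>. indicat_real B (S (Suc n) \<omega>)) \<omega>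
        = indicat_real C \<omega> *\<^sub>R measure (K (S n \<omega>)) B"
      by eventually_elim simp
  qed measurable
  finally have *: "measure Q (C \<inter> S (Suc n) -` B) = (LINT \<omega>:C|Q. measure (K (S n \<omega>)) B)" .
  have "integrable Q (\<lambda>\<omega>. indicat_real C \<omega> *\<^sub>R measure (K (S n \<omega>)) B)"
    using K_prob by (intro integrable_const_bound[where B=1] AE_I2)
      (auto simp: indicator_def prob_space.prob_le_1)
  then have "ennreal (LINT \<omega>:C|Q. measure (K (S n \<omega>)) B)
      = (\<integral>\<^sup>+\<omega>. ennreal (indicat_real C \<omega> *\<^sub>R measure (K (S n \<omega>)) B) \<partial>Q)"
    unfolding set_lebesgue_integral_def by (subst nn_integral_eq_integral) auto
  also have "\<dots> = (\<integral>\<^sup>+\<omega>\<in>C. emeasure (K (S n \<omega>)) B \<partial>Q)"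
    using K_prob by (intro nn_integral_cong)
      (auto simp: indicator_def finite_measure.emeasure_eq_measure[OF prob_space.finite_measure])
  finally show ?thesis
    using * by (simp add: emeasure_eq_measure)
qed

text \<open>Joint functions of \<open>S n\<close> and \<open>S (Suc n)\<close> are required because
  an upward step is not a product event. Two finite measures on pairs agree on rectangles, hence
  everywhere, and \<open>f\<close> is integrated against both.\<close>

lemma nn_integral_chain_Suc:
  assumes C: "C \<in> sets (past_algebra Q S n)"
    and f [measurable]: "f \<in> borel_measurable (pos_borel \<Otimes>\<^sub>M pos_borel)"
  shows "(\<integral>\<^sup>+\<omega>\<in>C. f (S n \<omega>, S (Suc n) \<omega>) \<partial>Q) = (\<integral>\<^sup>+\<omega>\<in>C. (\<integral>\<^sup>+y. f (S n \<omega>, y) \<partial>K (S n \<omega>)) \<partial>Q)"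
proof -
  let ?N = "pos_borel \<Otimes>\<^sub>M pos_borel"
  let ?Q = "density Q (indicator C)"
  \<comment> \<open>\<open>?k \<omega>\<close> is the point mass at \<open>S n \<omega>\<close>
    times \<open>K (S n \<omega>)\<close>. Below, \<open>\<mu>\<close> is the law of the pair
    restricted to \<open>C\<close>, and \<open>\<nu>\<close> averages \<open>?k\<close> over
    \<open>C\<close>.\<close>
  let ?k = "\<lambda>\<omega>. distr (K (S n \<omega>)) ?N (Pair (S n \<omega>))"
  define \<mu> where "\<mu> = distr ?Q ?N (\<lambda>\<omega>. (S n \<omega>, S (Suc n) \<omega>))"
  define \<nu> where "\<nu> = ?Q \<bind> ?k"
  note [measurable] = past_algebra_sets_mono[OF C]
  have pair_meas: "(\<lambda>\<omega>. (S n \<omega>, S (Suc n) \<omega>)) \<in> ?Q \<rightarrow>\<^sub>M ?N"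
    unfolding measurable_density_eq1 by measurable
  have Q_ne: "space ?Q \<noteq> {}" using not_empty by simp
  have k_meas: "?k \<in> ?Q \<rightarrow>\<^sub>M subprob_algebra ?N"
    using measurable_compose[OF chain_measurable measurable_distr2[OF _ kernel_subprob[OF K], where f=Pair and N="?N"]]
    by (simp add: measurable_density_eq1 cong: measurable_cong_sets)
  have sets_K: "sets (K (S n \<omega>)) = sets pos_borel" if "\<omega> \<in> space Q" for \<omega>
    using sets_martingale_kernel[OF K chain_pos[OF that]] .
  have Pair_meas: "Pair (S n \<omega>) \<in> K (S n \<omega>) \<rightarrow>\<^sub>M ?N" if "\<omega> \<in> space Q" for \<omega>
    using measurable_space[OF chain_measurable that] sets_K[OF that]
    by (simp cong: measurable_cong_sets)
  have "\<mu> = \<nu>"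
  proof (rule measure_eqI_generator_eq[OF Int_stable_pair_measure_generator[of pos_borel pos_borel],
        where \<Omega>="space pos_borel \<times> space pos_borel" and A="\<lambda>_. space pos_borel \<times> space pos_borel"])
    show "{a \<times> b |a b. a \<in> sets pos_borel \<and> b \<in> sets pos_borel} \<subseteq> Pow (space pos_borel \<times> space pos_borel)"
      using sets.sets_into_space by blast
    show "sets \<mu> = sigma_sets (space pos_borel \<times> space pos_borel) {a \<times> b |a b. a \<in> sets pos_borel \<and> b \<in> sets pos_borel}"
      by (simp add: \<mu>_def sets_pair_measure)
    show "sets \<nu> = sigma_sets (space pos_borel \<times> space pos_borel) {a \<times> b |a b. a \<in> sets pos_borel \<and> b \<in> sets pos_borel}"
      unfolding \<nu>_def sets_pair_measure[symmetric] by (rule sets_bind[OF sets_kernel[OF k_meas] Q_ne])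
    fix X assume "X \<in> {a \<times> b |a b. a \<in> sets pos_borel \<and> b \<in> sets pos_borel}"
    then obtain A B where X: "X = A \<times> B" and [measurable]: "A \<in> sets pos_borel" "B \<in> sets pos_borel"
      by blast
    \<comment> \<open>The condition on the first coordinate concerns only the past, so it is
      absorbed into \<open>C\<close>.\<close>
    have C': "C \<inter> (S n -` A \<inter> space (past_algebra Q S n)) \<in> sets (past_algebra Q S n)"
      by (rule sets.Int[OF C measurable_sets[OF chain_past_measurable[OF order_refl]]]) measurable
    have "emeasure \<mu> X = emeasure ?Q ((\<lambda>\<omega>. (S n \<omega>, S (Suc n) \<omega>)) -` X \<inter> space Q)"
      unfolding \<mu>_def using emeasure_distr[OF pair_meas, of X] X by simp
    also have "\<dots> = (\<integral>\<^sup>+\<omega>. indicator C \<omega> * indicator ((\<lambda>\<omega>. (S n \<omega>, S (Suc n) \<omega>)) -` X \<inter> space Q) \<omega> \<partial>Q)"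
    proof (rule emeasure_density)
      show "(\<lambda>\<omega>. (S n \<omega>, S (Suc n) \<omega>)) -` X \<inter> space Q \<in> sets Q"
        using measurable_sets[OF pair_meas, of X] X by simp
    qed measurable
    also have "\<dots> = (\<integral>\<^sup>+\<omega>. indicator (C \<inter> (S n -` A \<inter> space (past_algebra Q S n)) \<inter> S (Suc n) -` B) \<omega> \<partial>Q)"
      unfolding X space_past_algebra by (intro nn_integral_cong) (auto simp: indicator_def)
    also have "\<dots> = emeasure Q (C \<inter> (S n -` A \<inter> space (past_algebra Q S n)) \<inter> S (Suc n) -` B)"
    proof (rule nn_integral_indicator)
      have "C \<inter> (S n -` A \<inter> space (past_algebra Q S n)) \<inter> S (Suc n) -` B = C \<inter> (S n -` A \<inter> space Q) \<inter> (S (Suc n) -` B \<inter> space Q)"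
        by (auto simp: space_past_algebra)
      then show "C \<inter> (S n -` A \<inter> space (past_algebra Q S n)) \<inter> S (Suc n) -` B \<in> sets Q" by simp
    qed
    also have "\<dots> = (\<integral>\<^sup>+\<omega>\<in>C \<inter> (S n -` A \<inter> space (past_algebra Q S n)). emeasure (K (S n \<omega>)) B \<partial>Q)"
      by (rule emeasure_past_chain_Suc[OF C']) measurable
    also have "\<dots> = (\<integral>\<^sup>+\<omega>. indicator C \<omega> * emeasure (?k \<omega>) X \<partial>Q)"
    proof (rule nn_integral_cong)
      fix \<omega> assume \<omega>: "\<omega> \<in> space Q"
      have "emeasure (?k \<omega>) X = emeasure (K (S n \<omega>)) (Pair (S n \<omega>) -` X \<inter> space (K (S n \<omega>)))"
        unfolding X by (intro emeasure_distr Pair_meas[OF \<omega>]) measurable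
      also have "Pair (S n \<omega>) -` X \<inter> space (K (S n \<omega>)) = (if S n \<omega> \<in> A then B else {})"
        using sets.sets_into_space[OF \<open>B \<in> sets pos_borel\<close>] sets_eq_imp_space_eq[OF sets_K[OF \<omega>]]
        unfolding X by auto
      finally show "emeasure (K (S n \<omega>)) B * indicator (C \<inter> (S n -` A \<inter> space (past_algebra Q S n))) \<omega>
          = indicator C \<omega> * emeasure (?k \<omega>) X"
        using \<omega> by (auto simp: indicator_def space_past_algebra)
    qed
    also have "\<dots> = (\<integral>\<^sup>+\<omega>. emeasure (?k \<omega>) X \<partial>?Q)"
    proof (rule nn_integral_density[symmetric])
      show "(\<lambda>\<omega>. emeasure (?k \<omega>) X) \<in> borel_measurable Q"
        using measurable_compose[OF k_meas measurable_emeasure_subprob_algebra[of X ?N]]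
        by (simp add: X)
    qed measurable
    also have "\<dots> = emeasure \<nu> X"
      unfolding \<nu>_def X by (rule emeasure_bind[OF Q_ne k_meas, symmetric]) measurable
    finally show "emeasure \<mu> X = emeasure \<nu> X" .
  next
    \<comment> \<open>The whole product is itself a rectangle, and its mass is at most that of
      \<open>C\<close>, so a constant exhausting sequence suffices.\<close>
    show "emeasure \<mu> (space pos_borel \<times> space pos_borel) \<noteq> \<infinity>" for i :: nat
    proof -
      have "emeasure \<mu> (space pos_borel \<times> space pos_borel) \<le> emeasure ?Q (space Q)"
        unfolding \<mu>_def using emeasure_space[of ?Q]
        by (subst emeasure_distr[OF pair_meas pair_measureI[OF sets.top sets.top]]) simp
      also have "\<dots> = emeasure Q C"
        by (subst emeasure_density) (simp_all flip: indicator_inter_arith add: Int_absorb1 sets.sets_into_space[OF past_algebra_sets_mono[OF C]])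
      finally show ?thesis by (auto simp: top_unique)
    qed
    show "range (\<lambda>_::nat. space pos_borel \<times> space pos_borel)
        \<subseteq> {a \<times> b |a b. a \<in> sets pos_borel \<and> b \<in> sets pos_borel}"
      using sets.top by blast
  qed simp
  have "(\<integral>\<^sup>+\<omega>\<in>C. f (S n \<omega>, S (Suc n) \<omega>) \<partial>Q) = (\<integral>\<^sup>+p. f p \<partial>\<mu>)"
    unfolding \<mu>_def by (subst nn_integral_distr[OF pair_meas]) (simp_all add: nn_integral_density mult.commute)
  also have "\<dots> = (\<integral>\<^sup>+\<omega>. (\<integral>\<^sup>+p. f p \<partial>?k \<omega>) \<partial>?Q)"
    unfolding \<open>\<mu> = \<nu>\<close> \<nu>_def by (rule nn_integral_bind[OF f k_meas])
  also have "\<dots> = (\<integral>\<^sup>+\<omega>. indicator C \<omega> * (\<integral>\<^sup>+p. f p \<partial>?k \<omega>) \<partial>Q)"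
  proof (rule nn_integral_density)
    show "(\<lambda>\<omega>. \<integral>\<^sup>+p. f p \<partial>?k \<omega>) \<in> borel_measurable Q"
      using measurable_compose[OF k_meas nn_integral_measurable_subprob_algebra[OF f]] by simp
  qed measurable
  also have "\<dots> = (\<integral>\<^sup>+\<omega>\<in>C. (\<integral>\<^sup>+y. f (S n \<omega>, y) \<partial>K (S n \<omega>)) \<partial>Q)"
    by (intro nn_integral_cong) (simp add: nn_integral_distr[OF Pair_meas] mult.commute)
  finally show ?thesis .
qed

text \<open>Steps are counted from \<open>S 0\<close>, so \<open>n\<close> applications of
  \<open>T\<close> match \<open>n\<close> comparisons; the first one agrees with
  \<open>x \<le> S 1\<close> only almost surely.\<close>

definition up_event where
  "up_event n = {\<omega> \<in> space Q. \<forall>k<n. S k \<omega> \<le> S (Suc k) \<omega>}"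

lemma up_event_past: "up_event n \<in> sets (past_algebra Q S n)"
proof -
  have "{\<omega> \<in> space (past_algebra Q S n). S k \<omega> \<le> S (Suc k) \<omega>} \<in> sets (past_algebra Q S n)" if "k < n" for k
  proof (rule borel_measurable_le)
    show "S k \<in> borel_measurable (past_algebra Q S n)" "S (Suc k) \<in> borel_measurable (past_algebra Q S n)"
      using that measurable_compose[OF chain_past_measurable borel_measurable_id_pos_borel] by simp_all
  qed
  then have "{\<omega> \<in> space (past_algebra Q S n). \<forall>k\<in>{..<n}. S k \<omega> \<le> S (Suc k) \<omega>} \<in> sets (past_algebra Q S n)"
    by (intro sets.sets_Collect_finite_All) auto
  then show ?thesis
    unfolding up_event_def space_past_algebra Ball_def lessThan_iff .
qed

lemma up_event_sets [measurable]: "up_event n \<in> sets Q"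
  using up_event_past by (rule past_algebra_sets_mono)

text \<open>Integrating out the last step by the Markov property turns \<open>f\<close> at time
  \<open>n + 1\<close> into \<open>T f\<close> at time \<open>n\<close>. The induction therefore
  runs over all \<open>f\<close>.\<close>

lemma nn_integral_up_event:
  assumes [measurable]: "f \<in> borel_measurable pos_borel"
  shows "(\<integral>\<^sup>+\<omega>\<in>up_event n. f (S n \<omega>) \<partial>Q) = (up_op K ^^ n) f x"
  using assms
proof (induction n arbitrary: f)
  case 0
  have "(\<integral>\<^sup>+\<omega>\<in>up_event 0. f (S 0 \<omega>) \<partial>Q) = (\<integral>\<^sup>+\<omega>. f x \<partial>Q)"
  proof (rule nn_integral_cong_AE)
    have "AE \<omega> in Q. S 0 \<omega> = x" using chain by (simp add: markov_chain_def)
    then show "AE \<omega> in Q. f (S 0 \<omega>) * indicator (up_event 0) \<omega> = f x"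
      using AE_space by eventually_elim (simp add: up_event_def)
  qed
  then show ?case by (simp add: emeasure_space_1)
next
  case (Suc n)
  note [measurable] = Suc.prems
  \<comment> \<open>The half plane \<open>?D\<close> encodes the last upward step as a condition on
    the pair, leaving the past event \<open>up_event n\<close>.\<close>
  let ?D = "{p \<in> space (pos_borel \<Otimes>\<^sub>M pos_borel). fst p \<le> snd p}"
  have "(\<integral>\<^sup>+\<omega>\<in>up_event (Suc n). f (S (Suc n) \<omega>) \<partial>Q)
      = (\<integral>\<^sup>+\<omega>\<in>up_event n. (\<lambda>p. f (snd p) * indicator ?D p) (S n \<omega>, S (Suc n) \<omega>) \<partial>Q)"
    using chain_pos by (intro nn_integral_cong)
      (auto simp: up_event_def indicator_def less_Suc_eq space_pair_measure space_restrict_space)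
  also have "\<dots> = (\<integral>\<^sup>+\<omega>\<in>up_event n. (\<integral>\<^sup>+y. (\<lambda>p. f (snd p) * indicator ?D p) (S n \<omega>, y) \<partial>K (S n \<omega>)) \<partial>Q)"
    by (rule nn_integral_chain_Suc[OF up_event_past]) measurable
  also have "\<dots> = (\<integral>\<^sup>+\<omega>\<in>up_event n. up_op K f (S n \<omega>) \<partial>Q)"
  proof (rule nn_integral_cong)
    fix \<omega> assume "\<omega> \<in> space Q"
    then have "S n \<omega> > 0" by (rule chain_pos)
    then have "(\<integral>\<^sup>+y. (\<lambda>p. f (snd p) * indicator ?D p) (S n \<omega>, y) \<partial>K (S n \<omega>)) = up_op K f (S n \<omega>)"
      unfolding up_op_def by (intro nn_integral_cong)
        (auto simp: space_kernel[OF K] space_pair_measure space_restrict_space indicator_def)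
    then show "(\<integral>\<^sup>+y. (\<lambda>p. f (snd p) * indicator ?D p) (S n \<omega>, y) \<partial>K (S n \<omega>)) * indicator (up_event n) \<omega>
        = up_op K f (S n \<omega>) * indicator (up_event n) \<omega>" by simp
  qed
  also have "\<dots> = (up_op K ^^ Suc n) f x"
    using Suc.IH[OF up_op_measurable[OF K Suc.prems]] by (simp add: funpow_swap1)
  finally show ?case .
qed

section \<open>Integrability and the limit of the default sequence\<close>

lemma nn_integral_chain: "(\<integral>\<^sup>+\<omega>. ennreal (S n \<omega>) \<partial>Q) = ennreal x"
proof (induction n)
  case 0
  have "(\<integral>\<^sup>+\<omega>. ennreal (S 0 \<omega>) \<partial>Q) = (\<integral>\<^sup>+\<omega>. ennreal x \<partial>Q)"
    using chain by (intro nn_integral_cong_AE) (auto simp: markov_chain_def)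
  then show ?case by (simp add: emeasure_space_1)
next
  case (Suc n)
  have "(\<integral>\<^sup>+\<omega>\<in>space Q. ennreal (snd (S n \<omega>, S (Suc n) \<omega>)) \<partial>Q)
      = (\<integral>\<^sup>+\<omega>\<in>space Q. (\<integral>\<^sup>+y. ennreal (snd (S n \<omega>, y)) \<partial>K (S n \<omega>)) \<partial>Q)"
    using sets.top[of "past_algebra Q S n"]
    by (intro nn_integral_chain_Suc) (auto simp: space_past_algebra)
  also have "\<dots> = (\<integral>\<^sup>+\<omega>\<in>space Q. ennreal (S n \<omega>) \<partial>Q)"
    by (intro nn_integral_cong) (simp add: nn_integral_kernel_id[OF K] chain_pos)
  finally show ?case using Suc by (simp cong: nn_integral_cong)
qed

lemma integrable_chain: "integrable Q (S n)"
  using chain_pos by (intro integrableI_nonneg AE_I2) (auto simp: nn_integral_chain less_imp_le)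

text \<open>Fatou's lemma bounds the limit where it exists; elsewhere \<^const>\<open>lim\<close> is one fixed
  unspecified number, so no martingale convergence theorem is needed.\<close>

lemma integrable_S_lim: "integrable Q (S_lim S)"
proof (rule integrableI_bounded)
  show "S_lim S \<in> borel_measurable Q"
    unfolding S_lim_def[abs_def] by measurable
  define c where "c = (THE L::real. False)"
  have "(\<integral>\<^sup>+\<omega>. ennreal (norm (S_lim S \<omega>)) \<partial>Q)
      \<le> (\<integral>\<^sup>+\<omega>. liminf (\<lambda>n. ennreal (S n \<omega>)) + ennreal \<bar>c\<bar> \<partial>Q)"
  proof (rule nn_integral_mono)
    fix \<omega> assume \<omega>: "\<omega> \<in> space Q"
    show "ennreal (norm (S_lim S \<omega>)) \<le> liminf (\<lambda>n. ennreal (S n \<omega>)) + ennreal \<bar>c\<bar>"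
    proof (cases "convergent (\<lambda>n. S n \<omega>)")
      case True
      then have lim: "(\<lambda>n. S n \<omega>) \<longlonglongrightarrow> S_lim S \<omega>"
        by (simp add: S_lim_def convergent_LIMSEQ_iff)
      then have "(\<lambda>n. ennreal (S n \<omega>)) \<longlonglongrightarrow> ennreal (S_lim S \<omega>)" by simp
      then have "liminf (\<lambda>n. ennreal (S n \<omega>)) = ennreal (S_lim S \<omega>)"
        by (intro lim_imp_Liminf) auto
      moreover have "0 \<le> S_lim S \<omega>"
        using lim by (rule LIMSEQ_le_const) (use chain_pos[OF \<omega>] in \<open>auto intro: less_imp_le\<close>)
      ultimately show ?thesis by simp
    next
      case False
      then have "S_lim S \<omega> = c"
        by (auto simp: S_lim_def lim_def c_def convergent_def)
      then show ?thesis by simp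
    qed
  qed
  also have "\<dots> = (\<integral>\<^sup>+\<omega>. liminf (\<lambda>n. ennreal (S n \<omega>)) \<partial>Q) + ennreal \<bar>c\<bar>"
    by (subst nn_integral_add) (auto simp: emeasure_space_1)
  also have "\<dots> \<le> liminf (\<lambda>n. \<integral>\<^sup>+\<omega>. ennreal (S n \<omega>) \<partial>Q) + ennreal \<bar>c\<bar>"
    by (intro add_right_mono nn_integral_liminf) measurable
  also have "\<dots> < \<infinity>" by (simp add: nn_integral_chain Liminf_const)
  finally show "(\<integral>\<^sup>+\<omega>. ennreal (norm (S_lim S \<omega>)) \<partial>Q) < \<infinity>" .
qed

lemma integral_up_event:
  "(LINT \<omega>|Q. S n \<omega> * indicat_real (up_event n) \<omega>) = enn2real ((up_op K ^^ n) ennreal x)"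
proof (subst integral_eq_nn_integral)
  have "(\<lambda>\<omega>. S n \<omega>) \<in> borel_measurable Q"
    using integrable_chain by (rule borel_measurable_integrable)
  then show "(\<lambda>\<omega>. S n \<omega> * indicat_real (up_event n) \<omega>) \<in> borel_measurable Q"
    by measurable
  show "AE \<omega> in Q. 0 \<le> S n \<omega> * indicat_real (up_event n) \<omega>"
    using chain_pos by (intro AE_I2) (simp add: less_imp_le)
  have "(\<integral>\<^sup>+\<omega>. ennreal (S n \<omega> * indicat_real (up_event n) \<omega>) \<partial>Q) = (\<integral>\<^sup>+\<omega>\<in>up_event n. ennreal (S n \<omega>) \<partial>Q)"
    by (intro nn_integral_cong) (simp add: indicator_def)
  then show "enn2real (\<integral>\<^sup>+\<omega>. ennreal (S n \<omega> * indicat_real (up_event n) \<omega>) \<partial>Q) = enn2real ((up_op K ^^ n) ennreal x)"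
    by (simp add: nn_integral_up_event)
qed

text \<open>The upward events decrease and have probability at most \<open>q ^ n\<close>, so almost
  surely the indicator is eventually 0. Dominated convergence with bound
  \<open>norm (S_lim S \<omega>)\<close> finishes.\<close>

lemma integral_S_lim_up_event_tendsto:
  assumes q: "\<And>y. y > 0 \<Longrightarrow> 1 - down_prob K y \<le> q" "0 \<le> q" "q < 1"
  shows "(\<lambda>n. LINT \<omega>|Q. S_lim S \<omega> * indicat_real (up_event n) \<omega>) \<longlonglongrightarrow> 0"
proof -
  have emeasure_le: "emeasure Q (up_event n) \<le> ennreal (q ^ n)" for n
    using nn_integral_up_event[of "\<lambda>_. 1" n] up_op_pow_const_le[OF K q(1,2) x, of n 1] by simp
  have "emeasure Q (\<Inter>n. up_event n) \<le> 0"
  proof (rule LIMSEQ_le_const)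
    have "(\<lambda>n. ennreal (q ^ n)) \<longlonglongrightarrow> ennreal 0"
      using q by (intro tendsto_ennrealI LIMSEQ_realpow_zero) auto
    then show "(\<lambda>n. ennreal (q ^ n)) \<longlonglongrightarrow> 0" by simp
    have "emeasure Q (\<Inter>n. up_event n) \<le> emeasure Q (up_event n)" for n
      by (intro emeasure_mono) auto
    then show "\<exists>N. \<forall>n\<ge>N. emeasure Q (\<Inter>n. up_event n) \<le> ennreal (q ^ n)"
      using emeasure_le order_trans by blast
  qed
  then have "AE \<omega> in Q. \<omega> \<notin> (\<Inter>n. up_event n)"
    by (intro AE_not_in null_setsI) auto
  then have conv: "AE \<omega> in Q. (\<lambda>n. S_lim S \<omega> * indicat_real (up_event n) \<omega>) \<longlonglongrightarrow> 0"
  proof eventually_elim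
    case (elim \<omega>)
    then obtain m where m: "\<omega> \<notin> up_event m" by auto
    have "\<omega> \<notin> up_event n" if "n \<ge> m" for n
      using m that unfolding up_event_def by (auto dest: order.strict_trans2)
    then have "eventually (\<lambda>n. S_lim S \<omega> * indicat_real (up_event n) \<omega> = 0) sequentially"
      unfolding eventually_sequentially by (intro exI[of _ m]) auto
    then show ?case by (rule tendsto_eventually)
  qed
  have "(\<lambda>n. LINT \<omega>|Q. S_lim S \<omega> * indicat_real (up_event n) \<omega>) \<longlonglongrightarrow> (LINT \<omega>|Q. 0)"
  proof (rule integral_dominated_convergence[where w="\<lambda>\<omega>. norm (S_lim S \<omega>)"])
    note [measurable] = borel_measurable_integrable[OF integrable_S_lim]
    show "(\<lambda>\<omega>. S_lim S \<omega> * indicat_real (up_event n) \<omega>) \<in> borel_measurable Q" for n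
      by measurable
    show "integrable Q (\<lambda>\<omega>. norm (S_lim S \<omega>))" using integrable_S_lim by (rule integrable_norm)
    show "AE \<omega> in Q. norm (S_lim S \<omega> * indicat_real (up_event n) \<omega>) \<le> norm (S_lim S \<omega>)" for n
      by (auto simp: indicator_def)
  qed (use conv in auto)
  then show ?thesis by simp
qed

text \<open>For \<open>n > 0\<close> the default event is almost surely \<open>up_event n\<close>.
  The integral splits into \<open>T^n id x\<close>, which decreases to its infimum, and an
  \<open>S_lim\<close> term that vanishes in the limit.\<close>

lemma default_sequence_tendsto:
  assumes q: "\<And>y. y > 0 \<Longrightarrow> 1 - down_prob K y \<le> q" "0 \<le> q" "q < 1"
  shows "(\<lambda>n. LINT \<omega>|Q. (S n \<omega> - S_lim S \<omega>) *
      indicat_real {\<omega>. x \<le> S 1 \<omega> \<and> (\<forall>k\<in>{1..<n}. S k \<omega> \<le> S (Suc k) \<omega>)} \<omega>)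
    \<longlonglongrightarrow> enn2real (INF n. (up_op K ^^ n) ennreal x)"
proof -
  let ?I = "\<lambda>n. LINT \<omega>|Q. (S n \<omega> - S_lim S \<omega>) *
      indicat_real {\<omega>. x \<le> S 1 \<omega> \<and> (\<forall>k\<in>{1..<n}. S k \<omega> \<le> S (Suc k) \<omega>)} \<omega>"
  have I: "?I n = enn2real ((up_op K ^^ n) ennreal x) - (LINT \<omega>|Q. S_lim S \<omega> * indicat_real (up_event n) \<omega>)"
    if "n > 0" for n
  proof -
    note [measurable] = borel_measurable_integrable[OF integrable_S_lim]
    have AE0: "AE \<omega> in Q. S 0 \<omega> = x" using chain by (simp add: markov_chain_def)
    \<comment> \<open>Separates the comparison of \<open>S 0\<close> with \<open>S 1\<close>, where
      \<open>S 0\<close> is almost surely \<open>x\<close>, from the later ones. At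
      \<open>n = 0\<close> this fails: the default event still demands
      \<open>x \<le> S 1\<close>.\<close>
    have split: "(\<forall>k<n. P k) \<longleftrightarrow> P 0 \<and> (\<forall>k\<in>{1..<n}. P k)" for P
    proof (intro iffI allI impI)
      show "P k" if "P 0 \<and> (\<forall>k\<in>{1..<n}. P k)" "k < n" for k
        using that by (cases k) auto
    qed (use that in auto)
    have [measurable]: "S k \<in> borel_measurable Q" for k
      using integrable_chain by auto
    have "?I n = (LINT \<omega>|Q. (S n \<omega> - S_lim S \<omega>) * indicat_real (up_event n) \<omega>)"
    proof (rule integral_cong_AE)
      \<comment> \<open>The default event is not confined to \<open>space Q\<close>; measurability
        is proved for its trace there and then transferred.\<close>
      have [measurable]: "{\<omega> \<in> space Q. x \<le> S 1 \<omega> \<and> (\<forall>k\<in>{1..<n}. S k \<omega> \<le> S (Suc k) \<omega>)} \<in> sets Q"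
        by measurable
      have "(\<lambda>\<omega>. (S n \<omega> - S_lim S \<omega>) *
          indicat_real {\<omega> \<in> space Q. x \<le> S 1 \<omega> \<and> (\<forall>k\<in>{1..<n}. S k \<omega> \<le> S (Suc k) \<omega>)} \<omega>) \<in> borel_measurable Q"
        by measurable
      then show "(\<lambda>\<omega>. (S n \<omega> - S_lim S \<omega>) *
          indicat_real {\<omega>. x \<le> S 1 \<omega> \<and> (\<forall>k\<in>{1..<n}. S k \<omega> \<le> S (Suc k) \<omega>)} \<omega>) \<in> borel_measurable Q"
        by (rule measurable_cong[THEN iffD1, rotated]) (auto simp: indicator_def)
      show "AE \<omega> in Q. (S n \<omega> - S_lim S \<omega>) *
          indicat_real {\<omega>. x \<le> S 1 \<omega> \<and> (\<forall>k\<in>{1..<n}. S k \<omega> \<le> S (Suc k) \<omega>)} \<omega>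
          = (S n \<omega> - S_lim S \<omega>) * indicat_real (up_event n) \<omega>"
        using AE0 AE_space by eventually_elim (simp add: up_event_def split indicator_def)
    qed measurable
    also have "\<dots> = (LINT \<omega>|Q. S n \<omega> * indicat_real (up_event n) \<omega> - S_lim S \<omega> * indicat_real (up_event n) \<omega>)"
      by (simp add: left_diff_distrib)
    also have "\<dots> = (LINT \<omega>|Q. S n \<omega> * indicat_real (up_event n) \<omega>) - (LINT \<omega>|Q. S_lim S \<omega> * indicat_real (up_event n) \<omega>)"
      by (intro Bochner_Integration.integral_diff integrable_real_mult_indicator integrable_chain integrable_S_lim up_event_sets)
    finally show ?thesis by (simp add: integral_up_event)
  qed
  \<comment> \<open>Finiteness of the infimum makes \<open>enn2real\<close> continuous at the
    limit.\<close>
  have fin: "(INF n. (up_op K ^^ n) ennreal x) < \<top>"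
    by (rule le_less_trans[OF INF_lower[of 0]]) auto
  have "(\<lambda>n. (up_op K ^^ n) ennreal x) \<longlonglongrightarrow> (INF n. (up_op K ^^ n) ennreal x)"
    using up_op_pow_id_Suc_le[OF K x] by (intro LIMSEQ_INF decseq_SucI)
  then have "(\<lambda>n. enn2real ((up_op K ^^ n) ennreal x)) \<longlonglongrightarrow> enn2real (INF n. (up_op K ^^ n) ennreal x)"
    using fin by (intro tendsto_enn2real) (auto simp: less_top)
  from tendsto_diff[OF this integral_S_lim_up_event_tendsto[OF q]]
  have "(\<lambda>n. enn2real ((up_op K ^^ n) ennreal x) - (LINT \<omega>|Q. S_lim S \<omega> * indicat_real (up_event n) \<omega>))
      \<longlonglongrightarrow> enn2real (INF n. (up_op K ^^ n) ennreal x)" by simp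
  then show ?thesis
    by (rule Lim_transform_eventually)
       (use I in \<open>auto simp: eventually_sequentially intro!: exI[of _ 1]\<close>)
qed

end

subsection \<open>The largest solution and uniqueness\<close>

lemma SUP_ereal_less_top_iff:
  "(SUP x\<in>A. ereal (f x)) < \<infinity> \<longleftrightarrow> (\<exists>D. \<forall>x\<in>A. f x \<le> D)"
proof
  assume "(SUP x\<in>A. ereal (f x)) < \<infinity>"
  then obtain D :: nat where D: "(SUP x\<in>A. ereal (f x)) < ereal (real D)"
    by (auto simp: less_PInf_Ex_of_nat)
  have "f x \<le> real D" if "x \<in> A" for x
    using order.strict_trans1[OF SUP_upper[OF that, of "\<lambda>x. ereal (f x)"] D] by simp
  then show "\<exists>D. \<forall>x\<in>A. f x \<le> D" by blast
next
  assume "\<exists>D. \<forall>x\<in>A. f x \<le> D"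
  then obtain D where "\<forall>x\<in>A. f x \<le> D" by blast
  then have "(SUP x\<in>A. ereal (f x)) \<le> ereal D" by (intro SUP_least) simp
  then show "(SUP x\<in>A. ereal (f x)) < \<infinity>" by (rule le_less_trans) simp
qed

lemma sup_norm_less_top_iff: "sup_norm f < \<infinity> \<longleftrightarrow> (\<exists>D. \<forall>x>0. \<bar>f x\<bar> \<le> D)"
  unfolding sup_norm_def SUP_ereal_less_top_iff by (simp add: Ball_def)

text \<open>The limit of \<open>T^n id\<close>, which dominates every subsolution; it will turn out
  to be the default function on (0,\<infinity>).\<close>

definition max_solution :: "(real \<Rightarrow> real measure) \<Rightarrow> real \<Rightarrow> real" where
  "max_solution K x = enn2real (INF n. (up_op K ^^ n) ennreal x)"

context
  fixes K :: "real \<Rightarrow> real measure"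
  assumes K: "martingale_kernel K"
begin

text \<open>Allows passing from \<open>max_solution\<close> to the default function, which is
  identified with it only at positive arguments.\<close>

lemma solution_cong:
  assumes "\<And>y. y > 0 \<Longrightarrow> M y = N y"
  shows "solution K M \<longleftrightarrow> solution K N"
proof -
  have "M \<in> class_I \<longleftrightarrow> N \<in> class_I"
    unfolding class_I_def using assms measurable_cong[of pos_borel M N borel]
    by (simp add: space_restrict_space)
  moreover have "(LINT y:{x..}|K x. M y) = (LINT y:{x..}|K x. N y)" if "x > 0" for x
    unfolding set_lebesgue_integral_def using assms that
    by (intro Bochner_Integration.integral_cong) (auto simp: space_kernel[OF K])
  ultimately show ?thesis using assms by (simp add: solution_def)
qed

lemma ennreal_max_solution:
  "ennreal (max_solution K x) = (INF n. (up_op K ^^ n) ennreal x)"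
proof -
  have "(INF n. (up_op K ^^ n) ennreal x) < \<top>"
    by (rule le_less_trans[OF INF_lower[of 0]]) auto
  then show ?thesis by (simp add: max_solution_def)
qed

lemma max_solution_le:
  assumes "x > 0" shows "max_solution K x \<le> x"
proof -
  have "ennreal (max_solution K x) \<le> ennreal x"
    unfolding ennreal_max_solution by (rule INF_lower2[of 0]) auto
  then show ?thesis using assms by (subst (asm) ennreal_le_iff) auto
qed

lemma max_solution_solution: "solution K (max_solution K)"
proof -
  have "max_solution K \<in> borel_measurable pos_borel"
    unfolding max_solution_def[abs_def]
    by (intro borel_measurable_enn2real borel_measurable_INF up_op_pow_measurable[OF K]) auto
  then have "max_solution K \<in> class_I"
    using max_solution_le by (auto simp: class_I_def max_solution_def)
  then show ?thesis
    using up_op_INF_pow_id[OF K] by (simp add: solution_iff_up_op[OF K] ennreal_max_solution)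
qed

text \<open>Iterating the inequality gives \<open>M \<le> T^n M \<le> T^n id\<close> for every
  \<open>n\<close>.\<close>

lemma subsolution_le_max_solution:
  assumes M: "subsolution K M" and x: "x > 0"
  shows "M x \<le> max_solution K x"
proof -
  have "ennreal (M x) \<le> (up_op K ^^ n) ennreal x" for n
  proof -
    have "(up_op K ^^ n) (\<lambda>y. ennreal (M y)) x \<le> (up_op K ^^ n) ennreal x"
      using M by (intro up_op_pow_mono[OF K _ x]) (auto simp: subsolution_def class_I_def intro: ennreal_leI)
    then show ?thesis
      using subsolution_le_up_op_pow[OF K M x, of n] by (rule order_trans[rotated])
  qed
  then have "ennreal (M x) \<le> ennreal (max_solution K x)"
    unfolding ennreal_max_solution by (intro INF_greatest)
  then show ?thesis by (subst (asm) ennreal_le_iff) (auto simp: max_solution_def)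
qed

text \<open>The difference of two solutions is its own integral over \<open>{x..}\<close>, a set of
  mass at most \<open>q\<close>. It is signed, hence the real integral rather than
  \<open>up_op\<close>.\<close>

lemma solution_diff_le:
  assumes M: "solution K M" and N: "solution K N" and x: "x > 0"
    and q: "\<And>y. y > 0 \<Longrightarrow> 1 - down_prob K y \<le> q" and D: "\<And>y. y > 0 \<Longrightarrow> \<bar>M y - N y\<bar> \<le> D"
  shows "\<bar>M x - N x\<bar> \<le> D * q"
proof -
  interpret prob_space "K x" by (rule prob_space_kernel[OF K x])
  have MN: "M \<in> class_I" "N \<in> class_I" using M N by (auto simp: solution_def)
  note int = set_integrable_class_I[OF K MN(1) x] set_integrable_class_I[OF K MN(2) x]
  have int': "set_integrable (K x) {x..} (\<lambda>y. M y - N y)"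
    using int by (rule set_integral_diff(1))
  have "\<bar>M x - N x\<bar> = norm (LINT y:{x..}|K x. M y - N y)"
    using M N x int by (simp add: solution_def set_integral_diff(2))
  also have "\<dots> \<le> (LINT y:{x..}|K x. norm (M y - N y))"
    by (rule set_integral_norm_bound[OF int'])
  also have "\<dots> \<le> (LINT y:{x..}|K x. D)"
    using D x int' atLeast_sets_kernel[OF K x]
    by (intro set_integral_mono set_integrable_norm) (auto simp: set_integrable_def less_top[symmetric])
  also have "\<dots> = D * (1 - down_prob K x)"
    using atLeast_sets_kernel[OF K x] measure_atLeast_kernel[OF K x] by (simp add: set_lebesgue_integral_def)
  also have "\<dots> \<le> D * q"
    using D[OF x] q[OF x] by (intro mult_left_mono) auto
  finally show ?thesis .
qed

lemma solution_unique:
  assumes M: "solution K M" "sup_norm (\<lambda>x. x - M x) < \<infinity>"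
    and N: "solution K N" "sup_norm (\<lambda>x. x - N x) < \<infinity>"
    and q: "\<And>y. y > 0 \<Longrightarrow> 1 - down_prob K y \<le> q" "0 \<le> q" "q < 1" and x: "x > 0"
  shows "M x = N x"
proof -
  obtain D1 D2 where D12: "\<And>y. y > 0 \<Longrightarrow> \<bar>y - M y\<bar> \<le> D1" "\<And>y. y > 0 \<Longrightarrow> \<bar>y - N y\<bar> \<le> D2"
    using M(2) N(2) unfolding sup_norm_less_top_iff by blast
  \<comment> \<open>Both solutions are close to the identity, so the triangle inequality bounds
    their distance; the contraction then shrinks this bound geometrically.\<close>
  define D where "D = D1 + D2"
  have D: "\<bar>M y - N y\<bar> \<le> D" if "y > 0" for y
    using D12[OF that] unfolding D_def by linarith
  have "\<bar>M y - N y\<bar> \<le> D * q ^ n" if "y > 0" for y n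
    using that
  proof (induction n arbitrary: y)
    case (Suc n)
    show ?case
      using solution_diff_le[OF M(1) N(1) Suc.prems q(1) Suc.IH] by (simp add: mult_ac)
  qed (use D in simp)
  then have "\<bar>M x - N x\<bar> \<le> D * q ^ n" for n using x .
  moreover have "(\<lambda>n. D * q ^ n) \<longlonglongrightarrow> D * 0"
    using q by (intro tendsto_intros LIMSEQ_realpow_zero) auto
  ultimately have "\<bar>M x - N x\<bar> \<le> D * 0"
    by (intro LIMSEQ_le_const) auto
  then show ?thesis by simp
qed

text \<open>A solution satisfies \<open>M = T M \<le> T id\<close>, and \<open>T id x\<close> equals
  \<open>x - x b(x)\<close>.\<close>

lemma mult_down_mean_le:
  assumes M: "solution K M" and x: "x > 0"
  shows "x * down_mean K x \<le> x - M x"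
proof -
  have MI: "M \<in> class_I" using M by (simp add: solution_def)
  have "M x = (LINT y:{x..}|K x. M y)" using M x by (simp add: solution_def)
  also have "\<dots> \<le> (LINT y:{x..}|K x. y)"
    using MI x atLeast_sets_kernel[OF K x]
    by (intro set_integral_mono set_integrable_class_I[OF K] set_integrable_kernel_id[OF K])
       (auto simp: class_I_def)
  also have "\<dots> = x - x * down_mean K x"
    by (rule set_integral_atLeast_id[OF K x])
  finally show ?thesis by simp
qed

end

section \<open>Equivalence of the three conditions and uniqueness of the default function\<close>

theorem theorem3p12:
  fixes K :: "real \<Rightarrow> real measure"
    and P :: "real \<Rightarrow> 'w measure"
    and S :: "nat \<Rightarrow> 'w \<Rightarrow> real"
  assumes "martingale_kernel K"
    and "\<And>x. x > 0 \<Longrightarrow> markov_chain K x (P x) S"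
    and "(INF x\<in>{0<..}. down_prob K x) > 0"
  defines "M\<^sub>S \<equiv> default_function P S"
  defines "cond_a \<equiv> (SUP x\<in>{0<..}. ereal (x * down_mean K x)) < \<infinity>"
    and "cond_b \<equiv> (\<forall>\<^sub>F L in at_top. subsolution K (\<lambda>x. max (x - L) 0))"
    and "cond_c \<equiv> (\<exists>x>0. M\<^sub>S x \<noteq> 0) \<and> sup_norm (\<lambda>x. x - M\<^sub>S x) < \<infinity>"
  shows "(cond_a \<longleftrightarrow> cond_b) \<and> (cond_b \<longleftrightarrow> cond_c) \<and>
    (cond_a \<or> cond_b \<or> cond_c \<longrightarrow>
       solution K M\<^sub>S \<and> sup_norm (\<lambda>x. x - M\<^sub>S x) < \<infinity> \<and>
       (\<forall>M. solution K M \<and> sup_norm (\<lambda>x. x - M x) < \<infinity> \<longrightarrow> (\<forall>x>0. M x = M\<^sub>S x)))"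
proof -
  note K = assms(1)
  define c where "c = (INF x\<in>{0<..}. down_prob K x)"
  have c_pos: "c > 0" using assms(3) by (simp add: c_def)
  have c_le: "c \<le> down_prob K x" if "x > 0" for x
    unfolding c_def using that
    by (intro cINF_lower bdd_belowI2[where m=0]) (auto simp: down_prob_def)
  \<comment> \<open>Evaluating at the point 1 bounds the infimum by a probability, so the
    contraction factor \<open>1 - c\<close> is nonnegative.\<close>
  have "c \<le> 1"
    using order_trans[OF c_le[of 1]] prob_space.prob_le_1[OF prob_space_kernel[OF K, of 1]]
    by (simp add: down_prob_def)
  then have q: "\<And>y. y > 0 \<Longrightarrow> 1 - down_prob K y \<le> 1 - c" "0 \<le> 1 - c" "1 - c < 1"
    using c_le c_pos by auto
  have MS: "M\<^sub>S x = max_solution K x" if "x > 0" for x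
    unfolding M\<^sub>S_def default_function_def max_solution_def
    by (rule limI[OF default_sequence_tendsto[OF K assms(2)[OF that] that q]])
  have sol: "solution K M\<^sub>S"
    using solution_cong[OF K MS] max_solution_solution[OF K] by simp
  have ab: cond_b if a: cond_a
  proof -
    obtain D where D: "\<And>x. x > 0 \<Longrightarrow> x * down_mean K x \<le> D"
      using a unfolding cond_a_def SUP_ereal_less_top_iff by auto
    show cond_b
      unfolding cond_b_def
    proof (rule eventually_at_top_linorderI)
      \<comment> \<open>\<open>D / c \<le> L\<close> yields
        \<open>x b(x) \<le> D \<le> L c \<le> L a(x)\<close>; the 1 keeps the strike
        positive.\<close>
      fix L assume L: "max 1 (D / c) \<le> L"
      have "D \<le> L * c" using L c_pos by (simp add: pos_divide_le_eq)
      have "x * down_mean K x \<le> L * down_prob K x" if "x \<ge> L" for x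
      proof -
        have "x > 0" using L that by simp
        then have "L * c \<le> L * down_prob K x"
          using L by (intro mult_left_mono c_le) auto
        with D[OF \<open>x > 0\<close>] \<open>D \<le> L * c\<close> show ?thesis by linarith
      qed
      then show "subsolution K (\<lambda>x. max (x - L) 0)"
        using L by (subst subsolution_call_iff[OF K]) auto
    qed
  qed
  have bc: cond_c if b: cond_b
  proof -
    have "\<forall>\<^sub>F L in at_top. subsolution K (\<lambda>x. max (x - L) 0) \<and> L > 0"
      using b eventually_gt_at_top unfolding cond_b_def by (intro eventually_conj)
    then obtain L where L: "subsolution K (\<lambda>x. max (x - L) 0)" "L > 0"
      using eventually_happens'[OF trivial_limit_at_top_linorder] by blast
    have le: "max (x - L) 0 \<le> M\<^sub>S x" "M\<^sub>S x \<le> x" if "x > 0" for x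
      using subsolution_le_max_solution[OF K L(1) that] max_solution_le[OF K that] MS[OF that] by simp_all
    \<comment> \<open>At \<open>L + 1\<close> the call is worth 1, a positive lower bound.\<close>
    have "M\<^sub>S (L + 1) \<noteq> 0" using le[of "L + 1"] L(2) by auto
    moreover have "\<bar>x - M\<^sub>S x\<bar> \<le> L" if "x > 0" for x using le[OF that] by auto
    ultimately show cond_c
      using L(2) unfolding cond_c_def sup_norm_less_top_iff by (intro conjI exI[of _ "L + 1"] exI[of _ L]) auto
  qed
  have ca: cond_a if c: cond_c
  proof -
    obtain D where "\<And>x. x > 0 \<Longrightarrow> \<bar>x - M\<^sub>S x\<bar> \<le> D"
      using c unfolding cond_c_def sup_norm_less_top_iff by blast
    then have "x * down_mean K x \<le> D" if "x > 0" for x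
      using mult_down_mean_le[OF K sol that] that by (meson abs_ge_self order_trans)
    then show cond_a unfolding cond_a_def SUP_ereal_less_top_iff by auto
  qed
  \<comment> \<open>The implications proved so far form a cycle, so each condition yields
    \<open>cond_c\<close>, from which the final claims follow.\<close>
  have "solution K M\<^sub>S \<and> sup_norm (\<lambda>x. x - M\<^sub>S x) < \<infinity> \<and>
       (\<forall>M. solution K M \<and> sup_norm (\<lambda>x. x - M x) < \<infinity> \<longrightarrow> (\<forall>x>0. M x = M\<^sub>S x))" if cond_c
  proof -
    have fin: "sup_norm (\<lambda>x. x - M\<^sub>S x) < \<infinity>" using that by (simp add: cond_c_def)
    with sol show ?thesis using solution_unique[OF K _ _ sol fin q] by blast
  qed
  with ab bc ca show ?thesis by blast
qed

end
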